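(* Let $\mathbb{F}$ be an algebraically closed field of characteristic $2$. The derivation algebras of the $2$-dimensional evolution algebras $E_1(b,c)$ ($b,c\in\mathbb{F}$, $bc\ne1$), $E_2(b)$ ($b\in\mathbb{F}$), $E_3$, $E_4$, $E_5$, $E_6$ over $\mathbb{F}$ are as follows: \begin{itemize} \item $Der(E_1(b,c))=\{0\}$; \item $Der(E_2(b))=\{0\}$ if $b\neq0$; \item $Der(E_2(0))=\left\{\begin{pmatrix}0&0\\t&-t\end{pmatrix}: t\in\mathbb{F}\right\}$; \item $Der(E_3)=\{0\}$; \item $Der(E_4)=\left\{\begin{pmatrix}0&0\\0&t\end{pmatrix}: t\in\mathbb{F}\right\}$; \item $Der(E_5)=\left\{\begin{pmatrix}t&-t\\t&-t\end{pmatrix}: t\in\mathbb{F}\right\}$; \item $Der(E_6)=\left\{\begin{pmatrix}0&s\\0&t\end{pmatrix}: t,s\in\mathbb{F}\right\}$. \end{itemize}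
   Context: A $2$-dimensional algebra over $\mathbb{F}$ with basis $(e_1,e_2)$ and $e_i\cdot e_j=A^1_{i,j}e_1+A^2_{i,j}e_2$ is identified with its matrix of structure constants $$A=\begin{pmatrix} A^1_{1,1}&A^1_{1,2}&A^1_{2,1}&A^1_{2,2}\\ A^2_{1,1}&A^2_{1,2}&A^2_{2,1}&A^2_{2,2}\end{pmatrix},$$ so that in coordinate column vectors the product of $u$ and $v$ is $A(u\otimes v)$ (Kronecker product). The algebras considered (up to isomorphism, all the nontrivial $2$-dimensional evolution algebras over $\mathbb{F}$, i.e. algebras with nonzero multiplication having a basis with $e_1e_2=e_2e_1=0$) are $$E_{1}(b,c)=\begin{pmatrix} 1 & 0 & 0 & b\\ c & 0 & 0 & 1\end{pmatrix}\ (bc\neq1),\quad E_{2}(b)=\begin{pmatrix} 1 & 0 & 0 & b\\ 1 & 0 & 0 & 0\end{pmatrix},\quad E_{3}=\begin{pmatrix} 0 & 0 & 0 & 1\\ 1 & 0 & 0 & 0\end{pmatrix},$$ $$E_{4}=\begin{pmatrix} 1 & 0 & 0 & 1\\ 0 & 0 & 0 & 0\end{pmatrix},\quad E_5=\begin{pmatrix} 1 & 0 & 0 & -1\\ -1 & 0 & 0 & 1\end{pmatrix},\quad E_{6}=\begin{pmatrix} 0 & 0 & 0 & 1\\ 0 & 0 & 0 & 0\end{pmatrix}.$$ For an algebra with matrix of structure constants $E$, its algebra of derivations is $Der(E)=\{D\in M(2;\mathbb{F}):\ E(D\otimes I+I\otimes D)-DE=0\}$, where $M(2;\mathbb{F})$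 is the set of $2\times2$ matrices over $\mathbb{F}$ and $I$ is the $2\times 2$ identity matrix. *)

theory Defs
  imports "Jordan_Normal_Form.Matrix" "HOL-Computational_Algebra.Polynomial"
begin

definition kronecker :: "'a::semiring_1 mat \<Rightarrow> 'a mat \<Rightarrow> 'a mat" (infixl "\<otimes>\<^sub>K" 70) where
  "A \<otimes>\<^sub>K B = mat (dim_row A * dim_row B) (dim_col A * dim_col B)
     (\<lambda>(i, j). A $$ (i div dim_row B, j div dim_col B) * B $$ (i mod dim_row B, j mod dim_col B))"

text \<open>
  A 2-dimensional algebra is given by its 2 x 4 matrix of structure constants: the columns are
  the coordinates of \<open>e1 e1\<close>, \<open>e1 e2\<close>, \<open>e2 e1\<close>, \<open>e2 e2\<close>, in this order,
  which is the order of the coordinates of a Kronecker product of two vectors.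
\<close>

definition Der :: "'a::comm_ring_1 mat \<Rightarrow> 'a mat set" where
  "Der E = {D \<in> carrier_mat 2 2.
     E * (D \<otimes>\<^sub>K 1\<^sub>m 2 + 1\<^sub>m 2 \<otimes>\<^sub>K D) - D * E = 0\<^sub>m 2 4}"

definition E1 :: "'a::comm_ring_1 \<Rightarrow> 'a \<Rightarrow> 'a mat" where
  "E1 b c = mat_of_rows_list 4 [[1, 0, 0, b], [c, 0, 0, 1]]"

definition E2 :: "'a::comm_ring_1 \<Rightarrow> 'a mat" where
  "E2 b = mat_of_rows_list 4 [[1, 0, 0, b], [1, 0, 0, 0]]"

definition E3 :: "'a::comm_ring_1 mat" where
  "E3 = mat_of_rows_list 4 [[0, 0, 0, 1], [1, 0, 0, 0]]"

definition E4 :: "'a::comm_ring_1 mat" where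
  "E4 = mat_of_rows_list 4 [[1, 0, 0, 1], [0, 0, 0, 0]]"

definition E5 :: "'a::comm_ring_1 mat" where
  "E5 = mat_of_rows_list 4 [[1, 0, 0, -1], [-1, 0, 0, 1]]"

definition E6 :: "'a::comm_ring_1 mat" where
  "E6 = mat_of_rows_list 4 [[0, 0, 0, 1], [0, 0, 0, 0]]"

end

theory Submission
  imports Defs
begin

text \<open>
  Let \<open>u = e\<^sub>1 e\<^sub>1\<close> and \<open>v = e\<^sub>2 e\<^sub>2\<close>. In characteristic 2 a matrix \<open>D\<close> with off-diagonal
  entries \<open>q = D\<^sub>1\<^sub>2\<close> and \<open>r = D\<^sub>2\<^sub>1\<close> is a derivation iff \<open>D u = D v = 0\<close> and \<open>q u + r v = 0\<close>.
  If \<open>u\<close> and \<open>v\<close> are independent this forces \<open>D = 0\<close>; the other cases are small linear systems.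
\<close>

text \<open>Bounded quantifiers let \<open>All_less_Suc\<close> expand equality of matrices of known
  size into finitely many entry equations.\<close>

lemma mat_eq_iff_ball:
  "A = B \<longleftrightarrow> dim_row A = dim_row B \<and> dim_col A = dim_col B
    \<and> (\<forall>i<dim_row B. \<forall>j<dim_col B. A $$ (i, j) = B $$ (i, j))"
  by (auto simp: mat_eq_iff)

lemma mat_of_rows_list_2_2_eq_iff:
  "mat_of_rows_list 2 [[p, q], [r, s]] = mat_of_rows_list 2 [[p', q'], [r', s']]
    \<longleftrightarrow> p = p' \<and> q = q' \<and> r = r' \<and> s = s'"
  by (auto simp: mat_eq_iff_ball mat_of_rows_list_def numeral_2_eq_2 All_less_Suc)

lemma zero_mat_2_2: "0\<^sub>m 2 2 = mat_of_rows_list 2 [[0, 0], [0, 0]]"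
  by (simp add: mat_eq_iff_ball mat_of_rows_list_def numeral_2_eq_2 All_less_Suc)

lemma carrier_mat_2_2: "carrier_mat 2 2 = {mat_of_rows_list 2 [[p, q], [r, s]] | p q r s. True}"
proof -
  have "D = mat_of_rows_list 2 [[D $$ (0, 0), D $$ (0, 1)], [D $$ (1, 0), D $$ (1, 1)]]"
    if "D \<in> carrier_mat 2 2" for D :: "'a mat"
    using that by (auto simp: mat_eq_iff_ball mat_of_rows_list_def numeral_2_eq_2 All_less_Suc)
  moreover have "mat_of_rows_list 2 [[p, q], [r, s]] \<in> carrier_mat 2 2" for p q r s :: 'a
    by (simp add: mat_of_rows_list_def numeral_2_eq_2)
  ultimately show ?thesis
    by blast
qed

text \<open>Comparison by columns, over any commutative ring: the outer columns give
  \<open>D u = 2 p u\<close> and \<open>D v = 2 s v\<close>. Both middle columns give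
  \<open>q u + r v = 0\<close>, since the mixed products vanish.\<close>

lemma mem_Der_evolution_iff:
  fixes a b c d p q r s :: "'a::comm_ring_1"
  shows "mat_of_rows_list 2 [[p, q], [r, s]] \<in> Der (mat_of_rows_list 4 [[a, 0, 0, b], [c, 0, 0, d]])
    \<longleftrightarrow> p * a + q * c = 2 * p * a \<and> r * a + s * c = 2 * p * c
      \<and> p * b + q * d = 2 * s * b \<and> r * b + s * d = 2 * s * d
      \<and> q * a + r * b = 0 \<and> q * c + r * d = 0"
proof -
  have all_2: "(\<forall>i<2. P i) \<longleftrightarrow> P 0 \<and> P 1"
    and all_4: "(\<forall>i<4. P i) \<longleftrightarrow> P 0 \<and> P 1 \<and> P 2 \<and> P 3" for P :: "nat \<Rightarrow> bool"
    by (auto simp: numeral_eq_Suc All_less_Suc)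
  have sum_2: "sum f {0..<2} = f 0 + f 1"
    and sum_4: "sum f {0..<4} = f 0 + f 1 + f 2 + f 3" for f :: "nat \<Rightarrow> 'a"
    by (simp_all add: numeral_eq_Suc)
  have idx: "Suc (Suc (Suc 0)) div Suc (Suc 0) = Suc 0" "Suc (Suc (Suc 0)) mod Suc (Suc 0) = Suc 0"
    by (simp_all add: div_nat_eqI mod_Suc)
  show ?thesis
    unfolding Der_def kronecker_def
    by (auto simp: mat_eq_iff_ball mat_of_rows_list_def scalar_prod_def
        all_2 all_4 sum_2 sum_4 idx algebra_simps)
qed

theorem theorem4p2:
  assumes "CHAR('a::alg_closed_field) = 2"
  shows "(\<forall>b c :: 'a. b * c \<noteq> 1 \<longrightarrow> Der (E1 b c) = {0\<^sub>m 2 2})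
    \<and> (\<forall>b :: 'a. b \<noteq> 0 \<longrightarrow> Der (E2 b) = {0\<^sub>m 2 2})
    \<and> Der (E2 (0::'a)) = {mat_of_rows_list 2 [[0, 0], [t, - t]] | t. True}
    \<and> Der (E3 :: 'a mat) = {0\<^sub>m 2 2}
    \<and> Der (E4 :: 'a mat) = {mat_of_rows_list 2 [[0, 0], [0, t]] | t. True}
    \<and> Der (E5 :: 'a mat) = {mat_of_rows_list 2 [[t, - t], [t, - t]] | t. True}
    \<and> Der (E6 :: 'a mat) = {mat_of_rows_list 2 [[0, s], [0, t]] | s t. True}"
proof -
  have two: "(2::'a) = 0"
    using of_nat_CHAR[where 'a = 'a] assms by simp
  have neg: "- x = x" for x :: 'a
    using two by (metis add_eq_0_iff mult_2 mult_zero_left)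
  \<comment> \<open>Characteristic 2 enters here: the first four right-hand sides become 0.\<close>
  note mem_iff = mem_Der_evolution_iff[where ?'a = 'a, unfolded two mult_zero_left]
  have Der_eqI: "Der E = S"
    if "S \<subseteq> carrier_mat 2 2"
      and "\<And>p q r s. mat_of_rows_list 2 [[p, q], [r, s]] \<in> Der E
        \<longleftrightarrow> mat_of_rows_list 2 [[p, q], [r, s]] \<in> S"
    for E :: "'a mat" and S
  proof -
    have "Der E \<subseteq> carrier_mat 2 2"
      by (auto simp: Der_def)
    with that show ?thesis
      unfolding carrier_mat_2_2 by blast
  qed
  have indep: "Der (mat_of_rows_list 4 [[a, 0, 0, b], [c, 0, 0, d]]) = {0\<^sub>m 2 2}"
    if det: "a * d - b * c \<noteq> 0" for a b c d :: 'a
  proof (rule Der_eqI)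
    \<comment> \<open>A row vector killing both \<open>u = (a, c)\<close> and
      \<open>v = (b, d)\<close> is zero by Cramer's rule; this is applied to each row of
      \<open>D\<close>.\<close>
    have cramer: "x = 0 \<and> y = 0" if "x * a + y * c = 0" "x * b + y * d = 0" for x y
    proof -
      have "x * (a * d - b * c) = (x * a + y * c) * d - (x * b + y * d) * c"
        and "y * (a * d - b * c) = (x * b + y * d) * a - (x * a + y * c) * b"
        by (simp_all add: algebra_simps)
      with that have "x * (a * d - b * c) = 0" and "y * (a * d - b * c) = 0"
        by simp_all
      with det show ?thesis
        by simp
    qed
    show "mat_of_rows_list 2 [[p, q], [r, s]] \<in> Der (mat_of_rows_list 4 [[a, 0, 0, b], [c, 0, 0, d]])
        \<longleftrightarrow> mat_of_rows_list 2 [[p, q], [r, s]] \<in> {0\<^sub>m 2 2}" for p q r s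
      unfolding mem_iff zero_mat_2_2 singleton_iff mat_of_rows_list_2_2_eq_iff
      using cramer[of p q] cramer[of r s] by auto
  qed simp
  \<comment> \<open>The determinants \<open>a * d - b * c\<close> for \<open>E1 b c\<close>,
    \<open>E2 b\<close> and \<open>E3\<close> are \<open>1 - b * c\<close>, \<open>- b\<close> and
    \<open>- 1\<close>.\<close>
  have "Der (E1 b c) = {0\<^sub>m 2 2}" if "b * c \<noteq> 1" for b c :: 'a
    unfolding E1_def using that by (intro indep) auto
  moreover have "Der (E2 b) = {0\<^sub>m 2 2}" if "b \<noteq> 0" for b :: 'a
    unfolding E2_def using that by (intro indep) auto
  \<comment> \<open>Here \<open>u = (1, 1)\<close> and \<open>v = 0\<close>, so
    \<open>q = 0\<close>, hence \<open>p = 0\<close>, and \<open>r + s = 0\<close>.\<close>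
  moreover have "Der (E2 (0::'a)) = {mat_of_rows_list 2 [[0, 0], [t, - t]] | t. True}"
    unfolding E2_def
    by (rule Der_eqI) (auto simp: mem_iff mat_of_rows_list_2_2_eq_iff carrier_mat_2_2 add_eq_0_iff neg)
  moreover have "Der (E3 :: 'a mat) = {0\<^sub>m 2 2}"
    unfolding E3_def by (intro indep) auto
  \<comment> \<open>Here \<open>u = v = (1, 0)\<close>: the first column of \<open>D\<close>
    vanishes, and then \<open>q + r = 0\<close> gives \<open>q = 0\<close>.\<close>
  moreover have "Der (E4 :: 'a mat) = {mat_of_rows_list 2 [[0, 0], [0, t]] | t. True}"
    unfolding E4_def
    by (rule Der_eqI) (auto simp: mem_iff mat_of_rows_list_2_2_eq_iff carrier_mat_2_2)
  \<comment> \<open>Here \<open>v = - u\<close> with \<open>u = (1, -1)\<close>, so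
    \<open>p = q\<close>, \<open>r = s\<close> and \<open>q = r\<close>; the signs in the claimed
    form are harmless by \<open>neg\<close>.\<close>
  moreover have "Der (E5 :: 'a mat) = {mat_of_rows_list 2 [[t, - t], [t, - t]] | t. True}"
    unfolding E5_def
    by (rule Der_eqI) (auto simp: mem_iff mat_of_rows_list_2_2_eq_iff carrier_mat_2_2 add_eq_0_iff neg)
  \<comment> \<open>Here \<open>u = 0\<close> and \<open>v = (1, 0)\<close>: only the first column
    of \<open>D\<close> is forced to vanish.\<close>
  moreover have "Der (E6 :: 'a mat) = {mat_of_rows_list 2 [[0, s], [0, t]] | s t. True}"
    unfolding E6_def
    by (rule Der_eqI) (auto simp: mem_iff mat_of_rows_list_2_2_eq_iff carrier_mat_2_2)
  ultimately show ?thesis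
    by blast
qed

end
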